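(* Let $G$ be a group (not necessarily finite) and let $u$ be an element of the integral group ring $\mathbb{Z}G$. Let $p$ be a prime and let $q = q'\cdot m$ be a positive integer such that $m$ is the $p$-part of $q$ and $q'$ is not divisible by $p$. Then for every $s\in G$ we have $$\nu_{s}(u^{q}) \equiv \sum_{(r,t):\ r \mid t \mid q'} \mu(r) \cdot \Big( \sum_{x^{G}\in C_{r,t}(s)} \nu_{x}(u^{q'}) \Big) \pmod p,$$ where the outer sum runs over all pairs $(r,t)$ of positive integers with $r\mid t$ and $t\mid q'$, and, for each such pair, $C_{r,t}(s)$ denotes the set of conjugacy classes $x^{G}$ of $G$ for which $x^{m}$ is conjugate to $s$ in $G$ and there exists $y\in G$ with $y^{qr/t}=x^{m}$.
   Context: For $g\in G$, $g^G$ denotes the conjugacy class of $g$ in $G$. For $w=\sum_{g\in G}\alpha_g g\in\mathbb{Z}G$ (finitely many nonzero $\alpha_g\in\mathbb{Z}$) and $y\in G$, the partial augmentation of $w$ with respect to $y$ is $\nu_y(w)=\sum_{g\in y^G}\alpha_g$; it depends only on the conjugacy class of $y$, and for a given $w$ it is nonzero for only finitely many classes, so the inner sum has only finitely many nonzero terms. The $p$-part of a positive integer $q$ is the largest power of $p$ dividing $q$. $\mu$ is the Möbius function on positive integers: $\mu(1)=1$, $\mu(n)=0$ if $n$ is divisible by the square of a prime, and $\mu(n)=(-1)^{\ell}$ if $n$ is a product of $\ell$ distinct primes. The condition defining $C_{r,t}(s)$ does not depend on the representative $x$ of the class $x^G$; each class is counted once in the inner sum. *)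

theory Defs
  imports
    "HOL-Algebra.Ring"
    "HOL-Algebra.Group_Action"
    "HOL-Algebra.Free_Abelian_Groups"
    "HOL-Number_Theory.Cong"
begin

section \<open>The integral group ring\<close>

text \<open>
  Elements of the integral group ring of \<open>G\<close> are finitely supported functions with values in the
  integers whose support lies in \<open>carrier G\<close>; as in theory \<open>Free_Abelian_Groups\<close>, they are
  represented by the type of finitely supported maps. The convolution provided by
  \<open>Poly_Mapping\<close> refers to a type class structure on the index type and is not the one used here.
\<close>

definition integral_group_ring :: "('a, 'b) monoid_scheme \<Rightarrow> ('a \<Rightarrow>\<^sub>0 int) ring" where
  "integral_group_ring G =
     \<lparr>carrier = {w. Poly_Mapping.keys w \<subseteq> carrier G},
      monoid.mult = (\<lambda>v w. \<Sum>g\<in>Poly_Mapping.keys v. \<Sum>h\<in>Poly_Mapping.keys w.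
                Poly_Mapping.single (g \<otimes>\<^bsub>G\<^esub> h) (Poly_Mapping.lookup v g * Poly_Mapping.lookup w h)),
      monoid.one = Poly_Mapping.single \<one>\<^bsub>G\<^esub> 1,
      ring.zero = 0,
      ring.add = (+)\<rparr>"

lemma mult_integral_group_ring_eq_frag_extend:
  "v \<otimes>\<^bsub>integral_group_ring G\<^esub> w =
     frag_extend (\<lambda>g. frag_extend (\<lambda>h. frag_of (g \<otimes>\<^bsub>G\<^esub> h)) w) v"
proof -
  have *: "Poly_Mapping.single x (a * b) = frag_cmul a (frag_cmul b (frag_of x))" for a b and x :: 'a
    by (rule poly_mapping_eqI) (simp add: lookup_single when_def)
  show ?thesis
    by (simp add: integral_group_ring_def frag_extend_def frag_cmul_sum *
        del: frag_cmul_cmul)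
qed

lemma (in group) ring_integral_group_ring: "ring (integral_group_ring G)"
proof -
  let ?R = "integral_group_ring G"
  let ?m = "\<lambda>v w. frag_extend (\<lambda>g. frag_extend (\<lambda>h. frag_of (g \<otimes> h)) w) v"
  have carr: "carrier ?R = {w. Poly_Mapping.keys w \<subseteq> carrier G}"
    and one: "\<one>\<^bsub>?R\<^esub> = frag_of \<one>" and zero: "\<zero>\<^bsub>?R\<^esub> = 0"
    and add: "v \<oplus>\<^bsub>?R\<^esub> w = v + w" for v w
    by (simp_all add: integral_group_ring_def)
  note mult = mult_integral_group_ring_eq_frag_extend[where G = G]
  have addr: "?m v (w + x) = ?m v w + ?m v x" for v w x
    by (simp add: frag_extend_def frag_cmul_distrib frag_cmul_distrib2 sum.distrib
        frag_extend_add[unfolded frag_extend_def])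
  have addl: "?m (v + w) x = ?m v x + ?m w x" for v w x
    by (rule frag_extend_add)
  have subl: "?m (v - w) x = ?m v x - ?m w x" for v w x
    by (rule frag_extend_diff)
  have subr: "?m v (w - x) = ?m v w - ?m v x" for v w x
    using addr[where v = v and w = "w - x" and x = x] by (simp add: algebra_simps)
  have closed: "Poly_Mapping.keys (?m v w) \<subseteq> carrier G"
    if "Poly_Mapping.keys v \<subseteq> carrier G" "Poly_Mapping.keys w \<subseteq> carrier G" for v w
  proof -
    have "Poly_Mapping.keys (frag_extend (\<lambda>h. frag_of (g \<otimes> h)) w) \<subseteq> carrier G"
      if "g \<in> Poly_Mapping.keys v" for g
    proof (rule order_trans[OF keys_frag_extend])
      show "(\<Union>h\<in>Poly_Mapping.keys w. Poly_Mapping.keys (frag_of (g \<otimes> h))) \<subseteq> carrier G"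
        using that \<open>Poly_Mapping.keys v \<subseteq> carrier G\<close> \<open>Poly_Mapping.keys w \<subseteq> carrier G\<close>
        by (auto simp: keys_frag_of)
    qed
    then show ?thesis
      using keys_frag_extend by fastforce
  qed
  have onel: "frag_extend (\<lambda>h. frag_of (\<one> \<otimes> h)) w = w" if "Poly_Mapping.keys w \<subseteq> carrier G" for w
    using that by (subst (2) frag_expansion) (auto intro!: frag_extend_eq)
  have oner: "frag_extend (\<lambda>g. frag_of (g \<otimes> \<one>)) w = w" if "Poly_Mapping.keys w \<subseteq> carrier G" for w
    using that by (subst (2) frag_expansion) (auto intro!: frag_extend_eq)
  have assoc: "?m (?m u v) w = ?m u (?m v w)"
    if u: "Poly_Mapping.keys u \<subseteq> carrier G" and v: "Poly_Mapping.keys v \<subseteq> carrier G"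
      and w: "Poly_Mapping.keys w \<subseteq> carrier G" for u v w
    using w
  proof (induction w rule: frag_induction)
    case (one z)
    show ?case using v
    proof (induction v rule: frag_induction)
      case (one y)
      show ?case using u
      proof (induction u rule: frag_induction)
        case (one x)
        then show ?case using \<open>y \<in> carrier G\<close> \<open>z \<in> carrier G\<close> by (simp add: m_assoc)
      next
        case (diff a b)
        then show ?case by (simp only: subl)
      qed simp
    next
      case (diff a b)
      then show ?case by (simp only: subl subr)
    qed (simp add: frag_extend_def)
  next
    case (diff a b)
    then show ?case by (simp only: subr)
  qed (simp add: frag_extend_def)
  show ?thesis
  proof (rule ringI)
    show "abelian_group ?R"
    proof (rule abelian_groupI)
      fix x assume "x \<in> carrier ?R"
      then show "\<exists>y\<in>carrier ?R. y \<oplus>\<^bsub>?R\<^esub> x = \<zero>\<^bsub>?R\<^esub>"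
        by (intro bexI[of _ "- x"]) (auto simp: carr add zero)
    qed (use Poly_Mapping.keys_add in \<open>fastforce simp: carr add zero add_ac\<close>)+
    show "monoid ?R"
      by (rule monoidI) (use closed in \<open>auto simp: carr mult one onel oner assoc keys_frag_of\<close>)
  qed (simp_all add: mult add addl addr)
qed

section \<open>Conjugacy classes and partial augmentations\<close>

definition conj_class :: "('a, 'b) monoid_scheme \<Rightarrow> 'a \<Rightarrow> 'a set" where
  "conj_class G x = {h \<otimes>\<^bsub>G\<^esub> x \<otimes>\<^bsub>G\<^esub> inv\<^bsub>G\<^esub> h | h. h \<in> carrier G}"

lemma conj_class_eq_orbit:
  assumes "x \<in> carrier G"
  shows "conj_class G x = orbit G (\<lambda>g. \<lambda>h\<in>carrier G. g \<otimes>\<^bsub>G\<^esub> h \<otimes>\<^bsub>G\<^esub> inv\<^bsub>G\<^esub> g) x"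
  using assms by (auto simp: conj_class_def orbit_def)

text \<open>
  The intersection with the support keeps the sum finite: the class may be infinite, and
  a \<open>sum\<close> over an infinite set is \<open>0\<close> by convention.
\<close>

definition class_augmentation :: "('a \<Rightarrow>\<^sub>0 int) \<Rightarrow> 'a set \<Rightarrow> int" where
  "class_augmentation w K = (\<Sum>g\<in>K \<inter> Poly_Mapping.keys w. Poly_Mapping.lookup w g)"

definition partial_augmentation ::
    "('a, 'b) monoid_scheme \<Rightarrow> 'a \<Rightarrow> ('a \<Rightarrow>\<^sub>0 int) \<Rightarrow> int" where
  "partial_augmentation G y w = class_augmentation w (conj_class G y)"

text \<open>
  The exponent of \<open>y\<close> is the integer \<open>qr/t\<close>; the natural number division is
  exact whenever \<open>t\<close> divides \<open>q\<close>.
\<close>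

definition C_classes ::
    "('a, 'b) monoid_scheme \<Rightarrow> nat \<Rightarrow> nat \<Rightarrow> nat \<Rightarrow> nat \<Rightarrow> 'a \<Rightarrow> 'a set set" where
  "C_classes G q m r t s =
     {conj_class G x | x. x \<in> carrier G \<and> x [^]\<^bsub>G\<^esub> m \<in> conj_class G s \<and>
        (\<exists>y\<in>carrier G. y [^]\<^bsub>G\<^esub> (q * r div t) = x [^]\<^bsub>G\<^esub> m)}"

text \<open>
  \<open>C_classes\<close> may be infinite, but only finitely many classes have a nonzero partial augmentation.
  The sum over the classes is therefore taken over those.
\<close>

lemma (in group) finite_nonzero_class_augmentation:
  "finite {K \<in> C_classes G q m r t s. class_augmentation w K \<noteq> 0}"
proof (rule finite_subset)
  show "finite (conj_class G ` Poly_Mapping.keys w)"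
    by simp
  have *: "conj_class G g = conj_class G x" if "x \<in> carrier G" "g \<in> conj_class G x" for g x
  proof -
    interpret act: group_action G "carrier G" "\<lambda>g. \<lambda>h\<in>carrier G. g \<otimes> h \<otimes> inv g"
      by (rule action_by_conjugation)
    have g: "g \<in> carrier G"
      using that by (auto simp: conj_class_def)
    have "g \<in> orbit G (\<lambda>g. \<lambda>h\<in>carrier G. g \<otimes> h \<otimes> inv g) x"
      using that by (simp add: conj_class_eq_orbit)
    then show ?thesis
      unfolding conj_class_eq_orbit[OF g] conj_class_eq_orbit[OF that(1)]
      using act.orbit_sym[OF that(1) g] act.orbit_trans[OF that(1) g] act.orbit_trans[OF g that(1)]
        act.orbit_refl conj_class_eq_orbit[OF g] conj_class_eq_orbit[OF that(1)]
      by (smt (verit, ccfv_threshold) act.disjoint_union disjoint_iff orbits_def mem_Collect_eq g that(1))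
  qed
  show "{K \<in> C_classes G q m r t s. class_augmentation w K \<noteq> 0}
          \<subseteq> conj_class G ` Poly_Mapping.keys w"
  proof
    fix K assume K: "K \<in> {K \<in> C_classes G q m r t s. class_augmentation w K \<noteq> 0}"
    then obtain x where x: "x \<in> carrier G" "K = conj_class G x"
      by (auto simp: C_classes_def)
    have "K \<inter> Poly_Mapping.keys w \<noteq> {}"
      using K by (auto simp: class_augmentation_def)
    then show "K \<in> conj_class G ` Poly_Mapping.keys w"
      using x * by blast
  qed
qed

section \<open>The Moebius function\<close>

definition moebius :: "nat \<Rightarrow> int" where
  "moebius n = (if \<exists>p. prime p \<and> p\<^sup>2 dvd n then 0 else (-1) ^ card (prime_factors n))"

end

theory Submission
  imports Defs "HOL-Number_Theory.Residues"
begin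

text \<open>
  The divisibility conditions cancel: substituting \<open>e = (q'/t) r\<close>, the pairs \<open>r dvd t dvd q'\<close>
  correspond to the pairs \<open>r dvd e dvd q'\<close>, the exponent \<open>qr/t\<close> becomes \<open>me\<close>, and
  \<open>\<Sum>r | r dvd e. moebius r\<close> vanishes unless \<open>e = 1\<close>. What is left is the sum over all classes
  of elements \<open>x\<close> with \<open>x ^ m\<close> conjugate to \<open>s\<close>, so for \<open>v = u ^ q'\<close> one has to compare \<open>v ^ m\<close> with \<open>v\<close>.
  Expanding \<open>v ^ p\<close> into products over words of length \<open>p\<close>, cyclic rotation of a word conjugates its
  product. Hence modulo \<open>p\<close> only the constant words contribute to the augmentation over a
  conjugation-invariant set, and Fermat's little theorem removes the exponent of their coefficients.
  Iterating gives the power \<open>m\<close> of \<open>p\<close>.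
\<close>

section \<open>Sums of the Moebius function over divisors\<close>

text \<open>No new square of a prime divides \<open>p * r\<close>: for a prime other than
  \<open>p\<close> the square is coprime to \<open>p\<close>, and \<open>p\<^sup>2\<close> would
  force \<open>p\<close> to divide \<open>r\<close>. The set of prime factors gains exactly
  \<open>p\<close>, so the sign flips.\<close>

lemma moebius_prime_mult:
  assumes p: "prime p" and "\<not> p dvd r"
  shows "moebius (p * r) = - moebius r"
proof -
  have r: "r \<noteq> 0" "p \<noteq> 0"
    using assms by (metis dvd_0_right, metis not_prime_0)
  have "(l\<^sup>2 dvd p * r) = (l\<^sup>2 dvd r)" if l: "prime l" for l
  proof (cases "l = p")
    case True
    then show ?thesis
      using assms r by (auto simp: power2_eq_square dest: dvd_mult_left)
  next
    case False
    then have "coprime (l\<^sup>2) p"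
      using l p primes_coprime by auto
    then show ?thesis
      by (simp add: coprime_dvd_mult_right_iff)
  qed
  moreover have "prime_factors (p * r) = insert p (prime_factors r)"
    using p r by (simp add: prime_factors_product prime_prime_factors)
  moreover have "p \<notin> prime_factors r"
    using assms by auto
  ultimately show ?thesis
    unfolding moebius_def by auto
qed

text \<open>For a prime \<open>p\<close> dividing \<open>e\<close>, multiplication by
  \<open>p\<close> pairs the divisors prime to \<open>p\<close> (\<open>A\<close>) with those
  divisible by \<open>p\<close> exactly once (\<open>B\<close>), and paired terms cancel. The
  remaining divisors contain \<open>p\<^sup>2\<close> and contribute 0.\<close>

lemma sum_moebius_divisors:
  assumes "e > 0"
  shows "(\<Sum>r | r dvd e. moebius r) = (if e = 1 then 1 else 0)"
proof (cases "e = 1")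
  case True
  have "\<not> (\<exists>p. prime p \<and> p\<^sup>2 dvd (1::nat))"
    by auto
  then have "moebius 1 = 1"
    by (simp add: moebius_def)
  with True show ?thesis by simp
next
  case False
  then obtain p where p: "prime p" "p dvd e"
    using prime_factor_nat by blast
  define A where "A = {r. r dvd e \<and> \<not> p dvd r}"
  define B where "B = {r. r dvd e \<and> p dvd r \<and> \<not> p\<^sup>2 dvd r}"
  have fin: "finite {r. r dvd e}"
    using assms by simp
  have "(*) p ` A = B"
  proof (intro equalityI subsetI)
    fix x assume "x \<in> (*) p ` A"
    then obtain r where r: "x = p * r" "r dvd e" "\<not> p dvd r"
      by (auto simp: A_def)
    then have "coprime p r"
      using p prime_imp_coprime by blast
    then show "x \<in> B"
      using r p by (auto simp: B_def power2_eq_square divides_mult)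
  next
    fix x assume x: "x \<in> B"
    then obtain r where "x = p * r"
      by (auto simp: B_def)
    with x show "x \<in> (*) p ` A"
      by (auto simp: A_def B_def power2_eq_square dest: dvd_mult_right)
  qed
  then have "(\<Sum>r\<in>B. moebius r) = (\<Sum>r\<in>A. moebius (p * r))"
    using p by (auto simp: inj_on_def sum.reindex prime_gt_0_nat simp flip: \<open>(*) p ` A = B\<close>)
  also have "\<dots> = - (\<Sum>r\<in>A. moebius r)"
    using p by (simp add: A_def moebius_prime_mult flip: sum_negf)
  finally have AB: "(\<Sum>r\<in>A. moebius r) + (\<Sum>r\<in>B. moebius r) = 0"
    by simp
  have "(\<Sum>r | r dvd e. moebius r) = (\<Sum>r\<in>A \<union> B. moebius r)"
    using fin p by (intro sum.mono_neutral_right) (auto simp: A_def B_def moebius_def)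
  also have "\<dots> = (\<Sum>r\<in>A. moebius r) + (\<Sum>r\<in>B. moebius r)"
    by (rule sum.union_disjoint) (use fin in \<open>auto simp: A_def B_def\<close>)
  finally show ?thesis
    using AB False by simp
qed

text \<open>\<open>F\<close> is arbitrary because the inner sum of the theorem depends on the pair
  only through \<open>n div t * r\<close>. Once the pairs are grouped by this value, the Moebius sum
  over its divisors \<open>r\<close> remains as a factor.\<close>

lemma sum_moebius_divisor_pairs:
  fixes F :: "nat \<Rightarrow> int"
  assumes n: "n > 0"
  shows "(\<Sum>(r, t) | r dvd t \<and> t dvd n. moebius r * F (n div t * r)) = F 1"
proof -
  have "(\<Sum>(r, t) | r dvd t \<and> t dvd n. moebius r * F (n div t * r)) =
        (\<Sum>(e, r)\<in>(SIGMA e:{e. e dvd n}. {r. r dvd e}). F e * moebius r)"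
  proof (rule sum.reindex_bij_witness[where
        i = "\<lambda>(e, r). (r, n div (e div r))" and j = "\<lambda>(r, t). (n div t * r, r)"])
    \<comment> \<open>With \<open>n = r * k * l\<close> and \<open>t = r * k\<close> the new index
      is \<open>e = l * r\<close>; then \<open>e div r = l\<close> and \<open>n div l\<close> gives
      back \<open>t\<close>.\<close>
    fix a assume "a \<in> {(r, t). r dvd t \<and> t dvd n}"
    then obtain r k l where a: "a = (r, r * k)" "n = r * k * l"
      by (auto elim!: dvdE)
    show "(case case a of (r, t) \<Rightarrow> (n div t * r, r) of (e, r) \<Rightarrow> (r, n div (e div r))) = a"
      "(case a of (r, t) \<Rightarrow> (n div t * r, r)) \<in> (SIGMA e:{e. e dvd n}. {r. r dvd e})"
      using n a by auto
  next
    fix b assume "b \<in> (SIGMA e:{e. e dvd n}. {r. r dvd e})"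
    then obtain r k l where b: "b = (r * k, r)" "n = r * k * l"
      by (auto elim!: dvdE)
    have "n div k = r * l"
      using n b by simp
    then show "(case case b of (e, r) \<Rightarrow> (r, n div (e div r)) of (r, t) \<Rightarrow> (n div t * r, r)) = b"
      "(case b of (e, r) \<Rightarrow> (r, n div (e div r))) \<in> {(r, t). r dvd t \<and> t dvd n}"
      using n b by auto
  qed (auto simp: mult.commute)
  also have "\<dots> = (\<Sum>e | e dvd n. \<Sum>r | r dvd e. F e * moebius r)"
    using n by (subst sum.Sigma) (auto intro: dvd_pos_nat)
  also have "\<dots> = (\<Sum>e | e dvd n. F e * (if e = 1 then 1 else 0))"
    using n by (intro sum.cong refl) (auto simp: sum_moebius_divisors dvd_pos_nat simp flip: sum_distrib_left)
  also have "\<dots> = F 1"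
    using n by (simp add: if_distrib cong: if_cong)
  finally show ?thesis .
qed

section \<open>Sums over the fixed points of a permutation of prime order\<close>

text \<open>If \<open>e\<close> inverts \<open>d\<close> modulo \<open>n\<close>, the exponent
  \<open>d * e\<close> fixes \<open>x\<close> as a multiple of \<open>d\<close>, and modulo
  \<open>n\<close> it acts on \<open>x\<close> as the exponent 1.\<close>

lemma funpow_fixpoint_of_coprime:
  assumes "(f ^^ d) x = x" "(f ^^ n) x = x" "coprime d n"
  shows "f x = x"
proof (cases "n = 1")
  case False
  obtain e where e: "[d * e = Suc 0] (mod n)"
    using cong_solve_coprime_nat[OF assms(3)] by auto
  have "(f ^^ (d * e)) x = x"
    using funpow_mod_eq[of d f x "d * e"] assms(1) by simp
  then have "(f ^^ (d * e mod n)) x = x"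
    using funpow_mod_eq[OF assms(2)] by simp
  moreover have "(f ^^ (Suc 0 mod n)) x = f x"
    using funpow_mod_eq[OF assms(2), of "Suc 0"] by simp
  ultimately show ?thesis
    using e by (simp add: cong_def)
qed (use assms in simp)

text \<open>The orbit of a point that is not fixed has exactly \<open>p\<close> elements, since
  \<open>p\<close> is prime, and \<open>F\<close> is constant on it, so its contribution is a
  multiple of \<open>p\<close>. The induction removes one such orbit at a time.\<close>

lemma sum_cong_sum_fixpoints:
  fixes F :: "'a \<Rightarrow> int"
  assumes "finite A" and p: "prime p"
    and "\<And>x. x \<in> A \<Longrightarrow> \<sigma> x \<in> A"
    and "\<And>x. x \<in> A \<Longrightarrow> (\<sigma> ^^ p) x = x"
    and "\<And>x. x \<in> A \<Longrightarrow> F (\<sigma> x) = F x"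
  shows "[sum F A = sum F {x \<in> A. \<sigma> x = x}] (mod int p)"
  using assms(1,3-)
proof (induction A rule: finite_psubset_induct)
  case (psubset A)
  note closed = psubset.prems(1) and order = psubset.prems(2) and inv = psubset.prems(3)
  show ?case
  proof (cases "\<forall>x\<in>A. \<sigma> x = x")
    case True
    then have "{x \<in> A. \<sigma> x = x} = A" by auto
    then show ?thesis by simp
  next
    case False
    then obtain x where x: "x \<in> A" "\<sigma> x \<noteq> x" by auto
    define \<O> where "\<O> = (\<lambda>i. (\<sigma> ^^ i) x) ` {..<p}"
    have iter: "(\<sigma> ^^ i) y \<in> A \<and> F ((\<sigma> ^^ i) y) = F y" if "y \<in> A" for i y
      using that by (induction i) (auto simp: closed inv)
    have p0: "p > 0" using p prime_gt_0_nat by blast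
    \<comment> \<open>From equal images, \<open>p - 1\<close> further applications of
      \<open>\<sigma>\<close> lead back to the two points themselves.\<close>
    have inj: "inj_on \<sigma> A"
    proof (rule inj_onI)
      fix y z assume yz: "y \<in> A" "z \<in> A" "\<sigma> y = \<sigma> z"
      have "(\<sigma> ^^ p) y = (\<sigma> ^^ p) z"
        using yz(3) p0 by (cases p) (simp_all add: funpow_Suc_right del: funpow.simps)
      with yz order show "y = z" by simp
    qed
    have step: "\<sigma> ((\<sigma> ^^ i) x) = (\<sigma> ^^ (Suc i mod p)) x" for i
      using funpow_mod_eq[OF order[OF x(1)], of "Suc i"] by simp
    have \<O>_closed: "\<sigma> y \<in> \<O>" if "y \<in> \<O>" for y
      using that p0 by (auto simp: \<O>_def step)
    have \<O>A: "\<O> \<subseteq> A"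
      using iter x by (auto simp: \<O>_def)
    have fin\<O>: "finite \<O>" by (simp add: \<O>_def)
    \<comment> \<open>An injective self-map of a finite set is onto. This makes the complement of
      the orbit closed under \<open>\<sigma>\<close>, as the induction hypothesis requires.\<close>
    have \<O>_surj: "\<sigma> ` \<O> = \<O>"
      using \<O>_closed fin\<O> inj \<O>A by (intro card_subset_eq) (auto simp: card_image inj_on_subset)
    \<comment> \<open>The remaining \<open>p - i\<close> iterations carry
      \<open>(\<sigma> ^^ i) x\<close> back to \<open>x\<close>; a fixed point of the orbit would
      therefore be \<open>x\<close> itself.\<close>
    have nofix: "\<sigma> y \<noteq> y" if yO: "y \<in> \<O>" for y
    proof
      assume y: "\<sigma> y = y"
      obtain i where i: "i < p" "y = (\<sigma> ^^ i) x"
        using yO by (auto simp: \<O>_def)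
      have "(\<sigma> ^^ (p - i)) y = x"
        using i order[OF x(1)] by (simp flip: funpow_add[THEN fun_cong, simplified o_apply])
      moreover have "(\<sigma> ^^ k) y = y" for k
        using y by (induction k) auto
      ultimately show False using x y by auto
    qed
    \<comment> \<open>A coincidence at \<open>i < j\<close> makes \<open>(\<sigma> ^^ i) x\<close>
      fixed by both exponents \<open>j - i\<close> and \<open>p\<close>. They are coprime because
      \<open>0 < j - i < p\<close>, so the point would be fixed by \<open>\<sigma>\<close>.\<close>
    have injO: "inj_on (\<lambda>i. (\<sigma> ^^ i) x) {..<p}"
    proof (rule linorder_inj_onI')
      fix i j assume ij: "i \<in> {..<p}" "j \<in> {..<p}" "i < j"
      show "(\<sigma> ^^ i) x \<noteq> (\<sigma> ^^ j) x"
      proof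
        assume eq: "(\<sigma> ^^ i) x = (\<sigma> ^^ j) x"
        let ?y = "(\<sigma> ^^ i) x"
        have "(\<sigma> ^^ (j - i)) ?y = (\<sigma> ^^ (j - i + i)) x"
          by (simp only: funpow_add o_apply)
        then have "(\<sigma> ^^ (j - i)) ?y = ?y"
          using eq ij by simp
        moreover have "(\<sigma> ^^ p) ?y = ?y"
          using order iter x by blast
        moreover have "coprime (j - i) p"
        proof -
          have "\<not> p dvd (j - i)"
            using ij by (auto dest: dvd_imp_le)
          then show ?thesis
            using p by (simp add: prime_imp_coprime coprime_commute)
        qed
        ultimately have "\<sigma> ?y = ?y"
          by (rule funpow_fixpoint_of_coprime)
        then show False
          using nofix ij by (auto simp: \<O>_def)
      qed
    qed
    have "sum F \<O> = int p * F x"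
      using iter[OF x(1)] by (simp add: \<O>_def sum.reindex[OF injO])
    then have sumO: "[sum F \<O> = 0] (mod int p)"
      by (simp add: cong_0_iff)
    have "x \<in> \<O>"
      using p0 by (auto simp: \<O>_def intro!: image_eqI[of _ _ 0])
    then have "A - \<O> \<subset> A" using x by auto
    then have "[sum F (A - \<O>) = sum F {x \<in> A - \<O>. \<sigma> x = x}] (mod int p)"
    proof (rule psubset.IH)
      fix y assume y: "y \<in> A - \<O>"
      have "\<sigma> y \<notin> \<O>"
      proof
        assume "\<sigma> y \<in> \<O>"
        then obtain z where "z \<in> \<O>" "\<sigma> z = \<sigma> y"
          using \<O>_surj by (metis imageE)
        then show False
          using y inj \<O>A by (auto dest: inj_onD)
      qed
      then show "\<sigma> y \<in> A - \<O>" using y closed by auto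
    qed (use order inv in auto)
    moreover have "{x \<in> A - \<O>. \<sigma> x = x} = {x \<in> A. \<sigma> x = x}"
      using nofix by auto
    moreover have "sum F A = sum F (A - \<O>) + sum F \<O>"
      using \<O>A psubset.hyps by (simp add: sum.subset_diff)
    ultimately show ?thesis
      using cong_add[OF _ sumO] by simp
  qed
qed

text \<open>Coefficients may be negative, so \<open>a\<close> is replaced by its residue
  \<open>b\<close>, a natural number. If \<open>p\<close> divides \<open>b\<close>, both sides
  vanish modulo \<open>p\<close>; otherwise Fermat's theorem is multiplied by
  \<open>b\<close>.\<close>

lemma fermat_little_int:
  assumes "prime p"
  shows "[a ^ p = a] (mod int p)"
proof -
  have p0: "p > 0" using assms prime_gt_0_nat by blast
  define b where "b = nat (a mod int p)"
  have ab: "[a = int b] (mod int p)"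
    using p0 by (simp add: b_def cong_def)
  have "[b ^ p = b] (mod p)"
  proof (cases "p dvd b")
    case True
    then have "p dvd b ^ p"
      by (rule dvd_trans) (simp add: p0)
    with True show ?thesis
      by (simp add: cong_def mod_eq_0_iff_dvd)
  next
    case False
    then have "[b ^ (p - 1) * b = 1 * b] (mod p)"
      using assms by (intro cong_mult fermat_theorem cong_refl)
    then show ?thesis
      using p0 by (simp flip: power_Suc2)
  qed
  then have "[int b ^ p = int b] (mod int p)"
    by (simp flip: of_nat_power add: cong_int_iff)
  then have "[a ^ p = int b] (mod int p)"
    by (rule cong_trans[OF cong_pow[OF ab]])
  then show ?thesis
    by (rule cong_trans[OF _ cong_sym[OF ab]])
qed

section \<open>Powers in the group ring\<close>

text \<open>An augmentation over a set is the case where \<open>\<phi>\<close> is an indicator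
  function. General \<open>\<phi>\<close> is allowed because evaluating at a product replaces
  \<open>\<phi>\<close> by combinations of its translates.\<close>

definition linear_extension :: "('a \<Rightarrow> int) \<Rightarrow> ('a \<Rightarrow>\<^sub>0 int) \<Rightarrow> int" where
  "linear_extension \<phi> w = (\<Sum>g\<in>Poly_Mapping.keys w. Poly_Mapping.lookup w g * \<phi> g)"

lemma linear_extension_superset:
  assumes "finite A" "Poly_Mapping.keys w \<subseteq> A"
  shows "linear_extension \<phi> w = (\<Sum>g\<in>A. Poly_Mapping.lookup w g * \<phi> g)"
  unfolding linear_extension_def
  by (rule sum.mono_neutral_left) (use assms in \<open>auto simp: in_keys_iff\<close>)

lemma linear_extension_add:
  "linear_extension \<phi> (v + w) = linear_extension \<phi> v + linear_extension \<phi> w"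
proof -
  let ?A = "Poly_Mapping.keys v \<union> Poly_Mapping.keys w"
  have "linear_extension \<phi> x = (\<Sum>g\<in>?A. Poly_Mapping.lookup x g * \<phi> g)" if "x \<in> {v, w, v + w}" for x
    using that Poly_Mapping.keys_add[of v w] by (intro linear_extension_superset) auto
  then show ?thesis
    by (simp add: lookup_add distrib_right sum.distrib)
qed

lemma linear_extension_sum:
  "linear_extension \<phi> (\<Sum>i\<in>I. f i) = (\<Sum>i\<in>I. linear_extension \<phi> (f i))"
proof (induction I rule: infinite_finite_induct)
qed (auto simp: linear_extension_add, auto simp: linear_extension_def)

lemma linear_extension_single:
  "linear_extension \<phi> (Poly_Mapping.single x a) = a * \<phi> x"
  by (simp add: linear_extension_def)

lemma linear_extension_mult:
  "linear_extension \<phi> (v \<otimes>\<^bsub>integral_group_ring G\<^esub> w) =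
   linear_extension (\<lambda>g. linear_extension (\<lambda>h. \<phi> (g \<otimes>\<^bsub>G\<^esub> h)) w) v"
  by (simp add: integral_group_ring_def linear_extension_sum linear_extension_single)
     (simp add: linear_extension_def sum_distrib_left mult.assoc)

lemma class_augmentation_eq_linear_extension:
  "class_augmentation w K = linear_extension (\<lambda>g. of_bool (g \<in> K)) w"
  by (simp add: class_augmentation_def linear_extension_def of_bool_def if_distrib sum.If_cases
      Int_commute cong: if_cong)

abbreviation (in monoid) word_prod :: "'a list \<Rightarrow> 'a" where
  "word_prod xs \<equiv> foldr (\<otimes>) xs \<one>"

lemma (in monoid) word_prod_closed:
  "set xs \<subseteq> carrier G \<Longrightarrow> word_prod xs \<in> carrier G"
  by (induction xs) auto

lemma (in monoid) word_prod_snoc: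
  "set xs \<subseteq> carrier G \<Longrightarrow> x \<in> carrier G \<Longrightarrow> word_prod (xs @ [x]) = word_prod xs \<otimes> x"
  by (induction xs) (auto simp: m_assoc word_prod_closed[simplified])

lemma (in monoid) word_prod_replicate:
  "x \<in> carrier G \<Longrightarrow> word_prod (replicate n x) = x [^] n"
proof (induction n)
  case (Suc n)
  then have "word_prod (replicate (Suc n) x) = x \<otimes> x [^] n"
    by (simp del: foldr_replicate)
  also have "\<dots> = x [^] Suc n"
    using Suc.prems by (rule nat_pow_Suc2[symmetric])
  finally show ?case .
qed simp

text \<open>This is the noncommutative distributive law. The induction keeps \<open>\<phi>\<close>
  arbitrary: splitting off the last factor \<open>w\<close> turns \<open>\<phi>\<close> into the
  function \<open>\<lambda>g. linear_extension (\<lambda>h. \<phi> (g \<otimes> h)) w\<close>, to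
  which the hypothesis is applied.\<close>

lemma (in monoid) linear_extension_pow:
  assumes w: "w \<in> carrier (integral_group_ring G)"
  shows "linear_extension \<phi> (w [^]\<^bsub>integral_group_ring G\<^esub> n) =
    (\<Sum>xs | set xs \<subseteq> Poly_Mapping.keys w \<and> length xs = n.
       (\<Prod>x\<leftarrow>xs. Poly_Mapping.lookup w x) * \<phi> (word_prod xs))"
proof (induction n arbitrary: \<phi>)
  case 0
  have "{xs. set xs \<subseteq> Poly_Mapping.keys w \<and> length xs = 0} = {[]}" by auto
  then show ?case
    by (simp add: integral_group_ring_def linear_extension_single nat_pow_def)
next
  case (Suc n)
  let ?K = "Poly_Mapping.keys w" and ?c = "\<lambda>xs. \<Prod>x\<leftarrow>xs. Poly_Mapping.lookup w x"
  let ?W = "\<lambda>n. {xs. set xs \<subseteq> ?K \<and> length xs = n}"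
  have K: "?K \<subseteq> carrier G"
    using w by (simp add: integral_group_ring_def)
  have "w [^]\<^bsub>integral_group_ring G\<^esub> Suc n =
        w [^]\<^bsub>integral_group_ring G\<^esub> n \<otimes>\<^bsub>integral_group_ring G\<^esub> w"
    by (simp add: nat_pow_def)
  then have "linear_extension \<phi> (w [^]\<^bsub>integral_group_ring G\<^esub> Suc n) =
        (\<Sum>xs\<in>?W n. ?c xs * linear_extension (\<lambda>h. \<phi> (word_prod xs \<otimes> h)) w)"
    by (simp only: linear_extension_mult Suc)
  also have "\<dots> = (\<Sum>(xs, x)\<in>?W n \<times> ?K. ?c (xs @ [x]) * \<phi> (word_prod xs \<otimes> x))"
    by (simp add: linear_extension_def sum_distrib_left mult.assoc flip: sum.cartesian_product)
  also have "\<dots> = (\<Sum>(xs, x)\<in>?W n \<times> ?K. ?c (xs @ [x]) * \<phi> (word_prod (xs @ [x])))"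
    by (intro sum.cong refl)
       (clarsimp simp add: word_prod_snoc[OF subset_trans[OF _ K] subsetD[OF K]] simp del: foldr_append)
  also have "\<dots> = (\<Sum>xs\<in>?W (Suc n). ?c xs * \<phi> (word_prod xs))"
  \<comment> \<open>A word of length \<open>Suc n\<close> is nonempty and splits uniquely into its
    initial part and its last letter.\<close>
  proof (rule sum.reindex_bij_witness[where
        j = "\<lambda>(xs, x). xs @ [x]" and i = "\<lambda>xs. (butlast xs, last xs)"])
    fix xs assume "xs \<in> ?W (Suc n)"
    then show "(case (butlast xs, last xs) of (xs, x) \<Rightarrow> xs @ [x]) = xs"
      "(butlast xs, last xs) \<in> ?W n \<times> ?K"
      by (cases xs rule: rev_cases; auto)+
  qed auto
  finally show ?case .
qed

section \<open>Conjugation-invariant sets and rotation of words\<close>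

lemma (in group) conj_nat_pow:
  assumes "h \<in> carrier G" "x \<in> carrier G"
  shows "(h \<otimes> x \<otimes> inv h) [^] (n::nat) = h \<otimes> x [^] n \<otimes> inv h"
proof (induction n)
  case (Suc n)
  have "inv h \<otimes> (h \<otimes> (x \<otimes> inv h)) = x \<otimes> inv h"
    using assms by (simp flip: m_assoc)
  then show ?case
    using assms Suc by (simp add: m_assoc)
qed (use assms in simp)

text \<open>Arbitrary invariant sets are considered instead of single classes because the preimage
  of a class under a power map may consist of many classes.\<close>

definition conj_invariant :: "('a, 'b) monoid_scheme \<Rightarrow> 'a set \<Rightarrow> bool" where
  "conj_invariant G S \<longleftrightarrow>
     (\<forall>h\<in>carrier G. \<forall>x\<in>carrier G. x \<in> S \<longrightarrow> h \<otimes>\<^bsub>G\<^esub> x \<otimes>\<^bsub>G\<^esub> inv\<^bsub>G\<^esub> h \<in> S)"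

lemma (in group) conj_invariant_nat_pow_vimage:
  assumes "conj_invariant G S"
  shows "conj_invariant G {g \<in> carrier G. g [^] (n::nat) \<in> S}"
  using assms by (auto simp: conj_invariant_def conj_nat_pow)

text \<open>Rotation turns a product \<open>x \<otimes> y\<close>, with \<open>x\<close> the first
  letter, into \<open>y \<otimes> x\<close>, which is its conjugate by \<open>inv x\<close>.\<close>

lemma (in group) word_prod_rotate1_in_iff:
  assumes S: "conj_invariant G S" and xs: "set xs \<subseteq> carrier G"
  shows "word_prod (rotate1 xs) \<in> S \<longleftrightarrow> word_prod xs \<in> S"
proof (cases xs)
  case (Cons x ys)
  let ?y = "word_prod ys"
  have c: "x \<in> carrier G" "?y \<in> carrier G" "set ys \<subseteq> carrier G"
    using xs Cons word_prod_closed by auto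
  have "inv x \<otimes> (x \<otimes> ?y) \<otimes> inv (inv x) = ?y \<otimes> x" "x \<otimes> (?y \<otimes> x) \<otimes> inv x = x \<otimes> ?y"
    using c by (simp_all add: m_assoc inv_solve_left')
  then have "?y \<otimes> x \<in> S \<longleftrightarrow> x \<otimes> ?y \<in> S"
    using S c unfolding conj_invariant_def by (metis inv_closed m_closed)
  then show ?thesis
    using c word_prod_snoc[of ys x] by (simp add: Cons)
qed simp

section \<open>Augmentations of powers modulo p\<close>

lemma (in group) class_augmentation_prime_pow:
  assumes w: "w \<in> carrier (integral_group_ring G)" and p: "prime p" and S: "conj_invariant G S"
  shows "[class_augmentation (w [^]\<^bsub>integral_group_ring G\<^esub> p) S =
          class_augmentation w {g \<in> carrier G. g [^] p \<in> S}] (mod int p)"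
proof -
  let ?K = "Poly_Mapping.keys w" and ?c = "\<lambda>xs. \<Prod>x\<leftarrow>xs. Poly_Mapping.lookup w x"
  define F where "F xs = ?c xs * of_bool (word_prod xs \<in> S)" for xs
  define W where "W = {xs. set xs \<subseteq> ?K \<and> length xs = p}"
  have p0: "p > 0" using p prime_gt_0_nat by blast
  have K: "?K \<subseteq> carrier G"
    using w by (simp add: integral_group_ring_def)
  have "class_augmentation (w [^]\<^bsub>integral_group_ring G\<^esub> p) S = sum F W"
    by (simp add: class_augmentation_eq_linear_extension linear_extension_pow[OF w] F_def W_def)
  also have "[sum F W = sum F {xs \<in> W. rotate1 xs = xs}] (mod int p)"
  proof (rule sum_cong_sum_fixpoints[OF _ p])
    show "finite W"
      unfolding W_def by (rule finite_lists_length_eq) simp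
    fix xs assume xs: "xs \<in> W"
    then show "rotate1 xs \<in> W"
      by (simp add: W_def)
    show "(rotate1 ^^ p) xs = xs"
      using xs rotate_id[of p xs] by (simp add: W_def rotate_def)
    \<comment> \<open>The coefficients are integers and commute, so only the word product is
      affected by rotation.\<close>
    have "?c (rotate1 xs) = ?c xs"
      by (cases xs) (auto simp: mult.commute)
    then show "F (rotate1 xs) = F xs"
      using word_prod_rotate1_in_iff[OF S, of xs] xs K by (auto simp: F_def W_def)
  qed
  also have "{xs \<in> W. rotate1 xs = xs} = replicate p ` ?K"
  proof (intro equalityI subsetI)
    fix xs assume xs: "xs \<in> {xs \<in> W. rotate1 xs = xs}"
    \<comment> \<open>A word fixed by \<open>rotate1\<close> is empty or has a single distinct
      letter; its length \<open>p\<close> is positive, which excludes the empty word.\<close>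
    then obtain a where "set xs = {a}"
      using p0 rotate1_fixpoint_card[of xs] by (auto simp: W_def card_1_singleton_iff)
    then show "xs \<in> replicate p ` ?K"
      using xs replicate_eqI[of xs p a] by (auto simp: W_def)
  qed (auto simp: W_def)
  also have "sum F (replicate p ` ?K) =
      (\<Sum>g\<in>?K. Poly_Mapping.lookup w g ^ p * of_bool (g \<in> {g \<in> carrier G. g [^] p \<in> S}))"
  proof -
    have "inj_on (replicate p) ?K"
      using p0 by (auto simp: inj_on_def)
    then have "sum F (replicate p ` ?K) = (\<Sum>g\<in>?K. F (replicate p g))"
      by (simp only: sum.reindex o_def)
    moreover have "F (replicate p g) =
        Poly_Mapping.lookup w g ^ p * of_bool (g \<in> {g \<in> carrier G. g [^] p \<in> S})"
      if "g \<in> ?K" for g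
      using subsetD[OF K that] by (simp add: F_def word_prod_replicate del: foldr_replicate)
    ultimately show ?thesis
      by simp
  qed
  also have "[\<dots> = class_augmentation w {g \<in> carrier G. g [^] p \<in> S}] (mod int p)"
    unfolding class_augmentation_eq_linear_extension linear_extension_def
    by (rule cong_sum, rule cong_mult[OF fermat_little_int[OF p] cong_refl])
  finally show ?thesis .
qed

text \<open>The set \<open>S\<close> varies in the induction: taking off an outer
  \<open>p\<close>-th power replaces it by its preimage under the \<open>p\<close>-th power map,
  which is again conjugation-invariant.\<close>

lemma (in group) class_augmentation_prime_power_pow:
  assumes w: "w \<in> carrier (integral_group_ring G)" and p: "prime p" and "conj_invariant G S"
  shows "[class_augmentation (w [^]\<^bsub>integral_group_ring G\<^esub> (p ^ k)) S =
          class_augmentation w {g \<in> carrier G. g [^] (p ^ k) \<in> S}] (mod int p)"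
  using assms(3)
proof (induction k arbitrary: S)
  case 0
  interpret R: ring "integral_group_ring G" by (rule ring_integral_group_ring)
  \<comment> \<open>\<open>S\<close> may reach outside the group, but the support of
    \<open>w\<close> does not.\<close>
  have "S \<inter> Poly_Mapping.keys w = {g \<in> carrier G. g \<in> S} \<inter> Poly_Mapping.keys w"
    using w by (auto simp: integral_group_ring_def)
  moreover have "{g \<in> carrier G. g [^] (1::nat) \<in> S} = {g \<in> carrier G. g \<in> S}"
    by auto
  ultimately show ?case
    using w by (simp add: class_augmentation_def)
next
  case (Suc k)
  interpret R: ring "integral_group_ring G" by (rule ring_integral_group_ring)
  let ?T = "{g \<in> carrier G. g [^] p \<in> S}"
  have "w [^]\<^bsub>integral_group_ring G\<^esub> (p ^ Suc k) =
        (w [^]\<^bsub>integral_group_ring G\<^esub> (p ^ k)) [^]\<^bsub>integral_group_ring G\<^esub> p"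
    using w by (simp add: R.nat_pow_pow mult.commute)
  then have "[class_augmentation (w [^]\<^bsub>integral_group_ring G\<^esub> (p ^ Suc k)) S =
        class_augmentation (w [^]\<^bsub>integral_group_ring G\<^esub> (p ^ k)) ?T] (mod int p)"
    using class_augmentation_prime_pow[OF _ p Suc.prems] w by simp
  also have "[class_augmentation (w [^]\<^bsub>integral_group_ring G\<^esub> (p ^ k)) ?T =
        class_augmentation w {g \<in> carrier G. g [^] (p ^ k) \<in> ?T}] (mod int p)"
    by (rule Suc.IH) (rule conj_invariant_nat_pow_vimage[OF Suc.prems])
  also have "{g \<in> carrier G. g [^] (p ^ k) \<in> ?T} = {g \<in> carrier G. g [^] (p ^ Suc k) \<in> S}"
    by (auto simp: nat_pow_pow mult.commute)
  finally show ?case .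
qed

section \<open>Conjugacy classes\<close>

lemma (in group) conj_invariant_conj_class:
  assumes "x \<in> carrier G"
  shows "conj_invariant G (conj_class G x)"
  unfolding conj_invariant_def
proof (intro ballI impI)
  fix h g assume h: "h \<in> carrier G" "g \<in> carrier G" "g \<in> conj_class G x"
  then obtain k where "k \<in> carrier G" "g = k \<otimes> x \<otimes> inv k"
    by (auto simp: conj_class_def)
  then have "h \<otimes> g \<otimes> inv h = (h \<otimes> k) \<otimes> x \<otimes> inv (h \<otimes> k)" "h \<otimes> k \<in> carrier G"
    using assms h by (simp_all add: m_assoc inv_mult_group)
  then show "h \<otimes> g \<otimes> inv h \<in> conj_class G x"
    unfolding conj_class_def by blast
qed

lemma (in group) conj_class_refl: "x \<in> carrier G \<Longrightarrow> x \<in> conj_class G x"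
  by (auto simp: conj_class_def intro!: exI[of _ \<one>])

lemma (in group) conj_class_subset:
  "conj_invariant G S \<Longrightarrow> x \<in> carrier G \<Longrightarrow> x \<in> S \<Longrightarrow> conj_class G x \<subseteq> S"
  by (auto simp: conj_class_def conj_invariant_def)

lemma (in group) conj_class_eq:
  assumes x: "x \<in> carrier G" and g: "g \<in> conj_class G x"
  shows "conj_class G g = conj_class G x"
proof -
  obtain h where h: "h \<in> carrier G" "g = h \<otimes> x \<otimes> inv h"
    using g by (auto simp: conj_class_def)
  then have gc: "g \<in> carrier G" using x by simp
  have "x = inv h \<otimes> g \<otimes> inv (inv h)"
    using h x by (simp add: m_assoc inv_solve_left)
  then have "x \<in> conj_class G g"
    unfolding conj_class_def using h(1) by blast
  then show ?thesis
    using conj_class_subset conj_invariant_conj_class x g gc by blast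
qed

lemma (in group) disjoint_conj_classes:
  "pairwise disjnt (conj_class G ` carrier G)"
proof (rule pairwiseI, rule ccontr)
  fix K L
  assume "K \<in> conj_class G ` carrier G" "L \<in> conj_class G ` carrier G"
    and "K \<noteq> L" "\<not> disjnt K L"
  moreover from this(4) obtain g where "g \<in> K" "g \<in> L"
    by (auto simp: disjnt_def)
  ultimately show False
    using conj_class_eq by blast
qed

text \<open>The family may be infinite, and a member that meets the support may still have
  augmentation 0 by cancellation. Both are handled by passing to the members that meet the support:
  these are finitely many, and they cover the part of the support lying in the union.\<close>

lemma class_augmentation_Union:
  assumes "pairwise disjnt \<K>"
  shows "(\<Sum>K\<in>{K \<in> \<K>. class_augmentation w K \<noteq> 0}. class_augmentation w K) =
         class_augmentation w (\<Union>\<K>)"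
proof -
  define \<L> where "\<L> = {K \<in> \<K>. K \<inter> Poly_Mapping.keys w \<noteq> {}}"
  have disj: "K \<inter> L = {}" if "K \<in> \<L>" "L \<in> \<L>" "K \<noteq> L" for K L
    using assms that by (auto simp: \<L>_def pairwise_def disjnt_def)
  \<comment> \<open>Traces on the support of distinct members are nonempty and disjoint, hence
    distinct, and a finite set has only finitely many subsets.\<close>
  have "inj_on (\<lambda>K. K \<inter> Poly_Mapping.keys w) \<L>"
    using disj by (fastforce simp: inj_on_def \<L>_def)
  moreover have "finite ((\<lambda>K. K \<inter> Poly_Mapping.keys w) ` \<L>)"
    by (rule finite_subset[of _ "Pow (Poly_Mapping.keys w)"]) auto
  ultimately have fin: "finite \<L>"
    by (rule finite_imageD[rotated])
  have "(\<Sum>K\<in>{K \<in> \<K>. class_augmentation w K \<noteq> 0}. class_augmentation w K) =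
        (\<Sum>K\<in>\<L>. class_augmentation w K)"
    by (rule sum.mono_neutral_left[OF fin]) (auto simp: \<L>_def class_augmentation_def)
  also have "\<dots> = (\<Sum>g\<in>(\<Union>K\<in>\<L>. K \<inter> Poly_Mapping.keys w). Poly_Mapping.lookup w g)"
    unfolding class_augmentation_def
    by (rule sum.UNION_disjoint[symmetric]) (use fin disj in auto)
  also have "(\<Union>K\<in>\<L>. K \<inter> Poly_Mapping.keys w) = \<Union>\<K> \<inter> Poly_Mapping.keys w"
    by (auto simp: \<L>_def)
  finally show ?thesis
    by (simp add: class_augmentation_def)
qed

lemma (in group) Union_conj_classes:
  assumes "conj_invariant G S" "S \<subseteq> carrier G"
  shows "\<Union>(conj_class G ` S) = S"
  using assms conj_class_subset conj_class_refl by blast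

section \<open>The congruence for partial augmentations\<close>

theorem theorem2:
  fixes G :: "('a, 'b) monoid_scheme" (structure)
    and u :: "'a \<Rightarrow>\<^sub>0 int"
    and p q q' m :: nat
    and s :: 'a
  assumes "group G"
    and "u \<in> carrier (integral_group_ring G)"
    and "prime p"
    and "q > 0"
    and "q = q' * m"
    and "m = p ^ multiplicity p q"
    and "\<not> p dvd q'"
    and "s \<in> carrier G"
  shows "[partial_augmentation G s (u [^]\<^bsub>integral_group_ring G\<^esub> q) =
          (\<Sum>(r, t) \<in> {(r, t). r dvd t \<and> t dvd q'}.
             moebius r *
             (\<Sum>K \<in> {K \<in> C_classes G q m r t s.
                        class_augmentation (u [^]\<^bsub>integral_group_ring G\<^esub> q') K \<noteq> 0}.
                class_augmentation (u [^]\<^bsub>integral_group_ring G\<^esub> q') K))] (mod int p)"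
proof -
  interpret group G by fact
  interpret R: ring "integral_group_ring G" by (rule ring_integral_group_ring)
  define v where "v = u [^]\<^bsub>integral_group_ring G\<^esub> q'"
  have v: "v \<in> carrier (integral_group_ring G)"
    using assms(2) by (simp add: v_def)
  have q': "q' > 0" using assms(4,5) by simp
  \<comment> \<open>\<open>D e\<close> is the set of classes belonging to all pairs with
    \<open>e = q' div t * r\<close>, for which the exponent \<open>q * r div t\<close> is
    \<open>m * e\<close>.\<close>
  define D where "D e = {conj_class G x | x. x \<in> carrier G \<and> x [^] m \<in> conj_class G s \<and>
      (\<exists>y\<in>carrier G. y [^] (m * e) = x [^] m)}" for e
  define F where "F e = (\<Sum>K\<in>{K \<in> D e. class_augmentation v K \<noteq> 0}. class_augmentation v K)" for e
  define S where "S = {g \<in> carrier G. g [^] m \<in> conj_class G s}"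
  have "C_classes G q m r t s = D (q' div t * r)" if "t dvd q'" for r t
  proof -
    have "q * r div t = m * (q' div t * r)"
      using that q' by (auto simp: assms(5) elim!: dvdE)
    then show ?thesis
      by (simp add: C_classes_def D_def)
  qed
  then have "(\<Sum>(r, t) \<in> {(r, t). r dvd t \<and> t dvd q'}.
             moebius r *
             (\<Sum>K \<in> {K \<in> C_classes G q m r t s. class_augmentation v K \<noteq> 0}.
                class_augmentation v K)) =
        (\<Sum>(r, t) | r dvd t \<and> t dvd q'. moebius r * F (q' div t * r))"
    by (intro sum.cong refl) (auto simp: F_def)
  also have "\<dots> = F 1"
    by (rule sum_moebius_divisor_pairs[OF q'])
  also have "F 1 = class_augmentation v (\<Union>(conj_class G ` S))"
  proof -
    \<comment> \<open>For \<open>e = 1\<close> the element \<open>x\<close> is its own witness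
      \<open>y\<close>, so the root condition holds for every class.\<close>
    have "D 1 = conj_class G ` S"
      by (auto simp: D_def S_def)
    moreover have "pairwise disjnt (conj_class G ` S)"
      by (rule pairwise_subset[OF disjoint_conj_classes]) (auto simp: S_def)
    ultimately show ?thesis
      by (simp only: F_def class_augmentation_Union)
  qed
  also have "\<Union>(conj_class G ` S) = S"
    \<comment> \<open>\<open>S\<close> is the preimage of a conjugacy class under the
      \<open>m\<close>-th power map, hence a union of classes.\<close>
    unfolding S_def
    by (intro Union_conj_classes conj_invariant_nat_pow_vimage conj_invariant_conj_class assms) blast
  finally have rhs: "(\<Sum>(r, t) \<in> {(r, t). r dvd t \<and> t dvd q'}.
             moebius r *
             (\<Sum>K \<in> {K \<in> C_classes G q m r t s. class_augmentation v K \<noteq> 0}.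
                class_augmentation v K)) = class_augmentation v S" .
  have "u [^]\<^bsub>integral_group_ring G\<^esub> q = v [^]\<^bsub>integral_group_ring G\<^esub> m"
    using assms(2) by (simp add: v_def assms(5) R.nat_pow_pow)
  moreover have "[class_augmentation (v [^]\<^bsub>integral_group_ring G\<^esub> m) (conj_class G s) =
      class_augmentation v S] (mod int p)"
    using class_augmentation_prime_power_pow[OF v assms(3) conj_invariant_conj_class[OF assms(8)],
        of "multiplicity p q", folded assms(6)] by (simp only: S_def)
  ultimately show ?thesis
    using rhs by (simp only: partial_augmentation_def v_def)
qed

end
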